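(* Given a nonnegative bounded Jacobi matrix $J$ (see context), there always exist scaling transformations of the independent and dependent variables, unique up to an overall factor, such that the transformed Jacobi matrix $P$ is stochastic, i.e. $0\le P_{i,j}\le1$ and $\sum_{j=0}^{i+1}P_{i,j}=1$ for all $i\in\mathbb N_0$. If $\lambda\ge\|J\|_\infty$, we have $$P=\frac1\lambda\,\sigma J\sigma^{-1}$$ with $\sigma=\operatorname{diag}(\sigma_0,\sigma_1,\dots)$. Moreover, if $\sigma_0>0$ we have $\sigma_0\ge\sigma_1\ge\sigma_2\ge\cdots>0$, and if $\sigma_0<0$ we have $\sigma_0\le\sigma_1\le\sigma_2\le\cdots<0$. All $\frac{\sigma_n}{\sigma_{n-1}}$, $n\in\mathbb N$, are expressed as continued fractions of the coefficients of the matrix $J$. Moreover, $\sigma_n=f_n(J)\sigma_0$ for certain rational functions $f_n$ of the coefficients of the Jacobi matrix.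
   Context: General setting. $\Delta\subset\mathbb R$ is an interval, $\mu$ is a finite Borel measure on $\Delta$ that does not change sign and whose support has infinitely many points, $w_1,\dots,w_p$ are weights on $\Delta$ (real integrable functions that do not change sign on $\Delta$), and $\vec n=(n_1,\dots,n_p)$ is a vector of positive integers, $|\vec n|=n_1+\dots+n_p$. Every $i\in\mathbb N_0$ is written uniquely as $i=q(i)|\vec n|+n_1+\dots+n_{a(i)-1}+r(i)$ with $q(i)\in\mathbb N_0$, $a(i)\in\{1,\dots,p\}$, $0\le r(i)<n_{a(i)}$; put $k(i)=q(i)n_{a(i)}+r(i)$ and $\xi^{(i)}(x)=x^{k(i)}w_{a(i)}(x)$. The pair $(\mu,\vec w)$ is assumed perfect; in particular all leading principal minors of the moment matrix $g_{i,j}=\int_\Delta x^i\xi^{(j)}(x)\,d\mu(x)$ are nonzero. Then $B^{(l)}$ denotes the unique monic polynomial of degree $l$ with $\int_\Delta B^{(l)}\xi^{(j)}\,d\mu=0$ for $0\le j<l$, and with $B=(B^{(0)},B^{(1)},\dots)^\top$ the Jacobi matrix $J=(J_{i,j})_{i,j\in\mathbb N_0}$ is defined by $JB(x)=xB(x)$. With $N:=\max_a(|\vec n|-n_a+1)$ one has $J_{i,i+1}=1$ and $J_{i,j}=0$ unless $i-N\le j\le i+1$. It is nonnegative if all entries are $\ge0$ and bounded if $\|J\|_\infty=\sup_i\sum_j|J_{i,j}|<\infty$; the triple $(\vec n,\vec w,\mu)$ is assumed to be such that $J$ is nonnegative and bounded. Scaling the independent variable: for $\lambda\in\mathbb R\setminus\{0\}$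 put $\hat x=\lambda^{-1}x$ and $\hat B(\hat x)=B(\lambda\hat x)$; then $\hat J\hat B(\hat x)=\hat x\hat B(\hat x)$ with $J=\lambda\hat J$. Scaling the dependent variables: for a diagonal matrix $\sigma=\operatorname{diag}(\sigma_0,\sigma_1,\dots)$ put $\hat B=\sigma B$; then $\hat J\hat B(x)=x\hat B(x)$ with $\hat J_{k,l}=\frac{\sigma_k}{\sigma_l}J_{k,l}$. *)

theory Defs
  imports "HOL-Analysis.Analysis" "HOL-Computational_Algebra.Polynomial"
begin

section \<open>Stepped enumeration of the monomials times weights\<close>

text \<open>Components of multi-indices and vectors of weights are numbered from 1 to p.\<close>

definition msize :: "nat \<Rightarrow> (nat \<Rightarrow> nat) \<Rightarrow> nat" where
  "msize p n = (\<Sum>b=1..p. n b)"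

definition is_step :: "nat \<Rightarrow> (nat \<Rightarrow> nat) \<Rightarrow> nat \<Rightarrow> nat \<times> nat \<times> nat \<Rightarrow> bool" where
  "is_step p n i = (\<lambda>(q, a, r). a \<in> {1..p} \<and> r < n a \<and>
     i = q * msize p n + (\<Sum>b=1..<a. n b) + r)"

lemma is_step_ex1:
  assumes "p \<ge> 1" and pos: "\<And>b. b \<in> {1..p} \<Longrightarrow> n b > 0"
  shows "\<exists>!t. is_step p n i t"
proof -
  define S where "S = (\<lambda>a. \<Sum>b=1..<a. n b)"
  have S_Suc: "S (Suc a) = S a + n a" if "a \<ge> 1" for a
    using that by (simp add: S_def)
  have S_mono: "S a \<le> S b" if "a \<le> b" for a b
    unfolding S_def using that by (intro sum_mono2) auto
  have tot: "msize p n = S (Suc p)"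
    by (simp add: S_def msize_def atLeastLessThanSuc_atLeastAtMost)
  have below: "S a + r < msize p n" if "a \<in> {1..p}" "r < n a" for a r
    using that S_Suc[of a] S_mono[of "Suc a" "Suc p"] tot by auto
  have tot_pos: "msize p n > 0"
    using below[of 1 0] assms by auto
  define m where "m = i mod msize p n"
  define a where "a = (LEAST a. m < S (Suc a))"
  have m_less: "m < S (Suc p)"
    using tot tot_pos by (simp add: m_def)
  have a1: "m < S (Suc a)" and a2: "a \<le> p"
    unfolding a_def using m_less by (auto intro: LeastI Least_le)
  have a3: "a \<ge> 1"
    using a1 by (cases a) (auto simp: S_def)
  have a4: "S a \<le> m"
    using a3 not_less_Least[of "a - 1" "\<lambda>a. m < S (Suc a)"] by (auto simp: a_def)
  have ex: "is_step p n i (i div msize p n, a, m - S a)"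
  proof -
    have "m - S a < n a"
      using a1 a3 a4 S_Suc[of a] by linarith
    moreover have "i = i div msize p n * msize p n + S a + (m - S a)"
      using a4 div_mult_mod_eq[of i "msize p n"] unfolding m_def by linarith
    ultimately show ?thesis
      using a2 a3 unfolding is_step_def S_def by simp
  qed
  have "t = t'" if t: "is_step p n i t" and t': "is_step p n i t'" for t t'
  proof -
    obtain q a r q' a' r' where eq: "t = (q, a, r)" "t' = (q', a', r')"
      by (cases t, cases t') auto
    have 1: "a \<in> {1..p}" "r < n a" "i = q * msize p n + (S a + r)"
      and 2: "a' \<in> {1..p}" "r' < n a'" "i = q' * msize p n + (S a' + r')"
      using t t' by (auto simp: eq is_step_def S_def)
    have "i div msize p n = q" "i mod msize p n = S a + r"
      using 1(3) below[OF 1(1,2)] by auto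
    moreover have "i div msize p n = q'" "i mod msize p n = S a' + r'"
      using 2(3) below[OF 2(1,2)] by auto
    ultimately have q: "q = q'" and s: "S a + r = S a' + r'"
      by auto
    have "\<not> a < a'"
      using s 1 2 S_Suc[of a] S_mono[of "Suc a" a'] by auto
    moreover have "\<not> a' < a"
      using s 1 2 S_Suc[of a'] S_mono[of "Suc a'" a] by auto
    ultimately show ?thesis
      using q s by (auto simp: eq)
  qed
  with ex show ?thesis by blast
qed

definition step :: "nat \<Rightarrow> (nat \<Rightarrow> nat) \<Rightarrow> nat \<Rightarrow> nat \<times> nat \<times> nat" where
  "step p n i = (THE t. is_step p n i t)"

definition wmonom :: "nat \<Rightarrow> (nat \<Rightarrow> nat) \<Rightarrow> (nat \<Rightarrow> real \<Rightarrow> real) \<Rightarrow> nat \<Rightarrow> real \<Rightarrow> real" where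
  "wmonom p n w i x = (case step p n i of (q, a, r) \<Rightarrow> x ^ (q * n a + r) * w a x)"


section \<open>Multiple orthogonality\<close>

definition measure_support :: "real measure \<Rightarrow> real set" where
  "measure_support M =
     {x \<in> space M. \<forall>U. open U \<and> x \<in> U \<longrightarrow> emeasure M (U \<inter> space M) > 0}"

text \<open>
  A measure that does not change sign is \<open>\<epsilon>\<close> times a nonnegative measure, with \<open>\<epsilon>\<close> being 1 or -1.
\<close>

definition signed_integral :: "real \<Rightarrow> real measure \<Rightarrow> (real \<Rightarrow> real) \<Rightarrow> real" where
  "signed_integral \<epsilon> M f = \<epsilon> * (\<integral>x. f x \<partial>M)"

text \<open>
  Perfectness: every multi-index \<open>\<nu>\<close> is normal, that is, every nontrivial polynomial of degree
  at most \<open>\<bar>\<nu>\<bar>\<close> satisfying the \<open>\<bar>\<nu>\<bar>\<close> orthogonality relations has degree exactly \<open>\<bar>\<nu>\<bar>\<close>.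
\<close>

definition perfect_system ::
    "real \<Rightarrow> real measure \<Rightarrow> nat \<Rightarrow> (nat \<Rightarrow> real \<Rightarrow> real) \<Rightarrow> bool" where
  "perfect_system \<epsilon> M p w \<longleftrightarrow>
     (\<forall>\<nu> Q. Q \<noteq> 0 \<and> degree Q \<le> msize p \<nu> \<and>
        (\<forall>a\<in>{1..p}. \<forall>k<\<nu> a. signed_integral \<epsilon> M (\<lambda>x. poly Q x * (x ^ k * w a x)) = 0)
        \<longrightarrow> degree Q = msize p \<nu>)"

definition weight_system ::
    "real set \<Rightarrow> real \<Rightarrow> real measure \<Rightarrow> nat \<Rightarrow> (nat \<Rightarrow> nat) \<Rightarrow> (nat \<Rightarrow> real \<Rightarrow> real) \<Rightarrow> bool" where
  "weight_system \<Delta> \<epsilon> M p n w \<longleftrightarrow>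
     is_interval \<Delta> \<and>
     space M = \<Delta> \<and> sets M = sets (restrict_space borel \<Delta>) \<and> finite_measure M \<and>
     (\<epsilon> = 1 \<or> \<epsilon> = -1) \<and>
     infinite (measure_support M) \<and>
     p \<ge> 1 \<and> (\<forall>a\<in>{1..p}. n a > 0) \<and>
     (\<forall>a\<in>{1..p}. (\<forall>x\<in>\<Delta>. w a x \<ge> 0) \<or> (\<forall>x\<in>\<Delta>. w a x \<le> 0)) \<and>
     (\<forall>a\<in>{1..p}. \<forall>k. integrable M (\<lambda>x. x ^ k * w a x)) \<and>
     perfect_system \<epsilon> M p w"

definition multiple_orthogonal_polys ::
    "real \<Rightarrow> real measure \<Rightarrow> nat \<Rightarrow> (nat \<Rightarrow> nat) \<Rightarrow> (nat \<Rightarrow> real \<Rightarrow> real) \<Rightarrow> (nat \<Rightarrow> real poly) \<Rightarrow> bool"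
  where
  "multiple_orthogonal_polys \<epsilon> M p n w B \<longleftrightarrow>
     (\<forall>l. degree (B l) = l \<and> lead_coeff (B l) = 1 \<and>
          (\<forall>j<l. signed_integral \<epsilon> M (\<lambda>x. poly (B l) x * wmonom p n w j x) = 0))"


section \<open>Jacobi matrices and their scalings\<close>

text \<open>
  The relation \<open>J B = x B\<close>; the rows of \<open>J\<close> have finite support, so that \<open>J B\<close> makes sense.
\<close>

definition jacobi_matrix :: "(nat \<Rightarrow> real poly) \<Rightarrow> (nat \<Rightarrow> nat \<Rightarrow> real) \<Rightarrow> bool" where
  "jacobi_matrix B J \<longleftrightarrow>
     (\<forall>i. finite {j. J i j \<noteq> 0} \<and>
          (\<Sum>j | J i j \<noteq> 0. smult (J i j) (B j)) = [:0, 1:] * B i)"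

definition nonneg_matrix :: "(nat \<Rightarrow> nat \<Rightarrow> real) \<Rightarrow> bool" where
  "nonneg_matrix J \<longleftrightarrow> (\<forall>i j. J i j \<ge> 0)"

definition matrix_norm_inf :: "(nat \<Rightarrow> nat \<Rightarrow> real) \<Rightarrow> ennreal" where
  "matrix_norm_inf J = (SUP i. \<Sum>j. ennreal \<bar>J i j\<bar>)"

definition bounded_matrix :: "(nat \<Rightarrow> nat \<Rightarrow> real) \<Rightarrow> bool" where
  "bounded_matrix J \<longleftrightarrow> matrix_norm_inf J < \<infinity>"

definition stochastic_matrix :: "(nat \<Rightarrow> nat \<Rightarrow> real) \<Rightarrow> bool" where
  "stochastic_matrix P \<longleftrightarrow>
     (\<forall>i j. 0 \<le> P i j \<and> P i j \<le> 1) \<and> (\<forall>i. (\<Sum>j=0..i+1. P i j) = 1)"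

text \<open>The polynomials \<open>\<sigma>\<^sub>i B\<^sub>i(lam x)\<close> in the rescaled variable \<open>x\<close>.\<close>

definition scaled_polys ::
    "real \<Rightarrow> (nat \<Rightarrow> real) \<Rightarrow> (nat \<Rightarrow> real poly) \<Rightarrow> nat \<Rightarrow> real poly" where
  "scaled_polys lam \<sigma> B i = smult (\<sigma> i) (pcompose (B i) [:0, lam:])"

definition stochastic_scaling ::
    "(nat \<Rightarrow> real poly) \<Rightarrow> real \<Rightarrow> (nat \<Rightarrow> real) \<Rightarrow> (nat \<Rightarrow> nat \<Rightarrow> real) \<Rightarrow> bool" where
  "stochastic_scaling B lam \<sigma> P \<longleftrightarrow>
     lam \<noteq> 0 \<and> (\<forall>i. \<sigma> i \<noteq> 0) \<and>
     jacobi_matrix (scaled_polys lam \<sigma> B) P \<and> stochastic_matrix P"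


section \<open>Continued fractions and rational functions of the entries of a matrix\<close>

text \<open>
  \<open>cf_denom lam J m\<close> is the denominator of a finite (in general branched) continued fraction:
  with \<open>d\<^sub>m\<close> for \<open>cf_denom lam J m\<close>, it is
  \<open>d\<^sub>m = lam - J\<^sub>m\<^sub>,\<^sub>m - (J\<^sub>m\<^sub>,\<^sub>m\<^sub>-\<^sub>1 + (J\<^sub>m\<^sub>,\<^sub>m\<^sub>-\<^sub>2 + \<dots> + (J\<^sub>m\<^sub>,\<^sub>0 / d\<^sub>0) \<dots>) / d\<^sub>m\<^sub>-\<^sub>2) / d\<^sub>m\<^sub>-\<^sub>1\<close>.
  If \<open>J\<close> is tridiagonal, this is the classical
  \<open>d\<^sub>m = lam - J\<^sub>m\<^sub>,\<^sub>m - J\<^sub>m\<^sub>,\<^sub>m\<^sub>-\<^sub>1 / (lam - J\<^sub>m\<^sub>-\<^sub>1\<^sub>,\<^sub>m\<^sub>-\<^sub>1 - J\<^sub>m\<^sub>-\<^sub>1\<^sub>,\<^sub>m\<^sub>-\<^sub>2 / \<dots>)\<close>.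
\<close>

fun cf_denom :: "real \<Rightarrow> (nat \<Rightarrow> nat \<Rightarrow> real) \<Rightarrow> nat \<Rightarrow> real"
  and cf_tail :: "real \<Rightarrow> (nat \<Rightarrow> nat \<Rightarrow> real) \<Rightarrow> nat \<Rightarrow> nat \<Rightarrow> real" where
  "cf_denom lam J m = lam - J m m - cf_tail lam J m m"
| "cf_tail lam J m 0 = 0"
| "cf_tail lam J m (Suc k) = (J m k + cf_tail lam J m k) / cf_denom lam J k"

definition continued_fraction :: "real \<Rightarrow> (nat \<Rightarrow> nat \<Rightarrow> real) \<Rightarrow> nat \<Rightarrow> real" where
  "continued_fraction lam J n = 1 / cf_denom lam J (n - 1)"

text \<open>Compare the library's \<open>real_polynomial_function\<close> for finite-dimensional spaces.\<close>

inductive entry_polynomial :: "((nat \<Rightarrow> nat \<Rightarrow> real) \<Rightarrow> real) \<Rightarrow> bool" where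
  entry: "entry_polynomial (\<lambda>J. J i j)"
| const: "entry_polynomial (\<lambda>J. c)"
| add: "entry_polynomial f \<Longrightarrow> entry_polynomial g \<Longrightarrow> entry_polynomial (\<lambda>J. f J + g J)"
| mult: "entry_polynomial f \<Longrightarrow> entry_polynomial g \<Longrightarrow> entry_polynomial (\<lambda>J. f J * g J)"

definition entry_rational :: "((nat \<Rightarrow> nat \<Rightarrow> real) \<Rightarrow> real) \<Rightarrow> bool" where
  "entry_rational f \<longleftrightarrow>
     (\<exists>g h. entry_polynomial g \<and> entry_polynomial h \<and> (\<exists>J. h J \<noteq> 0) \<and> f = (\<lambda>J. g J / h J))"

end

theory Submission
  imports Defs
begin

text \<open>
  Writing \<open>s\<^sub>i = 1 / \<sigma>\<^sub>i\<close>, the row sums of \<open>\<sigma> J \<sigma>\<inverse> / lam\<close> are 1 if and only if \<open>J s = lam s\<close>.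
  As \<open>J\<close> is lower Hessenberg with ones on the superdiagonal, this is a recursion that determines
  \<open>s\<close> from \<open>s\<^sub>0\<close> (in fact \<open>s\<^sub>i = s\<^sub>0 B\<^sub>i(lam)\<close>). If \<open>J\<close> is nonnegative and \<open>lam\<close> bounds its row sums,
  an induction shows that \<open>s\<close> is positive and nondecreasing. The ratios \<open>s\<^sub>m\<^sub>+\<^sub>1 / s\<^sub>m\<close> satisfy the
  recursion of the denominators of the continued fraction.
\<close>

section \<open>Polynomial families with one member in every degree\<close>

definition graded_family :: "(nat \<Rightarrow> real poly) \<Rightarrow> bool" where
  "graded_family B \<longleftrightarrow> (\<forall>i. degree (B i) = i \<and> B i \<noteq> 0)"

text \<open>Members of smaller index have smaller degree, so only the one at \<open>Max S\<close>
  contributes to the coefficient there, and nothing can cancel it.\<close>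

lemma degree_combination:
  assumes B: "graded_family B" and S: "finite S" "S \<noteq> {}" and c: "c (Max S) \<noteq> 0"
  shows "degree (\<Sum>j\<in>S. smult (c j) (B j)) = Max S"
    and "lead_coeff (\<Sum>j\<in>S. smult (c j) (B j)) = c (Max S) * lead_coeff (B (Max S))"
proof -
  let ?m = "Max S" and ?Q = "\<Sum>j\<in>S. smult (c j) (B j)"
  have deg: "degree (B i) = i" and nz: "B i \<noteq> 0" for i
    using B by (auto simp: graded_family_def)
  have m: "?m \<in> S" using S by simp
  have "coeff ?Q ?m = (\<Sum>j\<in>S. c j * coeff (B j) ?m)"
    by (simp add: coeff_sum)
  also have "\<dots> = (\<Sum>j\<in>S. if j = ?m then c ?m * coeff (B ?m) ?m else 0)"
  proof (rule sum.cong[OF refl])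
    fix j assume "j \<in> S"
    then have "j \<le> ?m" using S by simp
    then show "c j * coeff (B j) ?m = (if j = ?m then c ?m * coeff (B ?m) ?m else 0)"
      by (auto intro!: coeff_eq_0 simp: deg)
  qed
  also have "\<dots> = c ?m * coeff (B ?m) ?m"
    using S m by simp
  finally have co: "coeff ?Q ?m = c ?m * lead_coeff (B ?m)"
    by (simp add: deg)
  have "lead_coeff (B ?m) \<noteq> 0" using nz by simp
  then have "?m \<le> degree ?Q"
    using co c by (intro le_degree) auto
  moreover have "degree ?Q \<le> ?m"
    using S by (intro degree_sum_le) (auto intro: order_trans[OF degree_smult_le] simp: deg)
  ultimately show d: "degree ?Q = ?m" by simp
  show "lead_coeff ?Q = c ?m * lead_coeff (B ?m)"
    using co by (simp add: d)
qed

lemma graded_family_independent: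
  assumes B: "graded_family B" and S: "finite S" and 0: "(\<Sum>j\<in>S. smult (c j) (B j)) = 0"
    and j: "j \<in> S"
  shows "c j = 0"
proof (rule ccontr)
  assume "c j \<noteq> 0"
  \<comment> \<open>Discarding zero coefficients makes the one at the top index nonzero. The zero
    sum would then have a nonzero leading coefficient.\<close>
  define T where "T = {k \<in> S. c k \<noteq> 0}"
  have T: "finite T" "T \<noteq> {}"
    using S j \<open>c j \<noteq> 0\<close> by (auto simp: T_def)
  have "Max T \<in> T" using T by simp
  then have c: "c (Max T) \<noteq> 0" by (simp add: T_def)
  have "(\<Sum>k\<in>T. smult (c k) (B k)) = (\<Sum>k\<in>S. smult (c k) (B k))"
    using S by (intro sum.mono_neutral_left) (auto simp: T_def)
  then have "lead_coeff (0 :: real poly) = c (Max T) * lead_coeff (B (Max T))"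
    using degree_combination(2)[where c = c, OF B T c] 0 by simp
  then show False
    using c B by (simp add: graded_family_def)
qed

section \<open>Jacobi matrices\<close>

text \<open>Row i holds the coefficients of x B_i in a linearly independent family.\<close>

lemma jacobi_matrix_unique:
  assumes B: "graded_family B" and J: "jacobi_matrix B J" and J': "jacobi_matrix B J'"
  shows "J = J'"
proof (intro ext)
  fix i j
  \<comment> \<open>The two expansions may have different supports; padding both with zeros to the
    union lets them be subtracted termwise.\<close>
  let ?S = "{j. J i j \<noteq> 0} \<union> {j. J' i j \<noteq> 0}"
  have S: "finite ?S"
    using J J' by (simp add: jacobi_matrix_def)
  have 1: "(\<Sum>j\<in>?S. smult (J i j) (B j)) = [:0, 1:] * B i"
    using J S by (subst sum.mono_neutral_right[of _ "{j. J i j \<noteq> 0}"])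
      (auto simp: jacobi_matrix_def)
  have 2: "(\<Sum>j\<in>?S. smult (J' i j) (B j)) = [:0, 1:] * B i"
    using J' S by (subst sum.mono_neutral_right[of _ "{j. J' i j \<noteq> 0}"])
      (auto simp: jacobi_matrix_def)
  have "(\<Sum>j\<in>?S. smult (J i j - J' i j) (B j)) = 0"
    using 1 2 by (simp add: smult_diff_left sum_subtractf)
  then have "J i j - J' i j = 0" if "j \<in> ?S"
    using graded_family_independent[OF B S, of "\<lambda>j. J i j - J' i j"] that by blast
  then show "J i j = J' i j"
    by (cases "j \<in> ?S") auto
qed

text \<open>By degree, the last nonzero entry of row i sits at i + 1, the degree of x B_i. As both
  sides are built from monic polynomials, that entry is 1.\<close>

lemma jacobi_matrix_hessenberg:
  assumes B: "graded_family B" and monic: "\<And>i. lead_coeff (B i) = 1" and J: "jacobi_matrix B J"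
  shows "J i (Suc i) = 1" and "j > Suc i \<Longrightarrow> J i j = 0"
proof -
  let ?S = "{j. J i j \<noteq> 0}"
  have S: "finite ?S" and eq: "(\<Sum>j\<in>?S. smult (J i j) (B j)) = [:0, 1:] * B i"
    using J by (auto simp: jacobi_matrix_def)
  have nz: "B i \<noteq> 0" and di: "degree (B i) = i"
    using B by (auto simp: graded_family_def)
  have d: "degree ([:0, 1:] * B i) = Suc i"
    using nz di by (subst degree_mult_eq) auto
  have l: "lead_coeff ([:0, 1:] * B i) = 1"
    using monic[of i] by (subst lead_coeff_mult) auto
  have ne: "?S \<noteq> {}"
  proof
    assume "?S = {}"
    then have "[:0, 1:] * B i = 0" using eq by simp
    then show False using d by simp
  qed
  have "Max ?S \<in> ?S" using S ne by (rule Max_in)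
  then have c: "J i (Max ?S) \<noteq> 0" by simp
  have m: "Max ?S = Suc i"
    using degree_combination(1)[where c = "J i", OF B S ne c] eq d by simp
  have "lead_coeff ([:0, 1:] * B i) = J i (Max ?S) * lead_coeff (B (Max ?S))"
    using degree_combination(2)[where c = "J i", OF B S ne c] eq by simp
  then show "J i (Suc i) = 1"
    using l m monic[of "Suc i"] by simp
  show "J i j = 0" if "j > Suc i"
    using Max_ge[OF S, of j] m that by (cases "J i j = 0") auto
qed

section \<open>Effect of scalings on the Jacobi matrix\<close>

lemma graded_family_scaled_polys:
  assumes "graded_family B" and "lam \<noteq> 0" and "\<And>i. \<sigma> i \<noteq> 0"
  shows "graded_family (scaled_polys lam \<sigma> B)"
proof -
  have "pcompose (B i) [:0, lam:] \<noteq> 0" for i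
    using assms pcompose_eq_0_iff[of "[:0, lam:]" "B i"] by (auto simp: graded_family_def)
  then show ?thesis
    using assms by (auto simp: graded_family_def scaled_polys_def degree_pcompose)
qed

text \<open>Substituting lam x for x in the recurrence turns the factor x into lam x, which accounts
  for the factor 1 / lam.\<close>

lemma jacobi_matrix_scaled_polys:
  assumes J: "jacobi_matrix B J" and lam: "lam \<noteq> 0" and \<sigma>: "\<And>i. \<sigma> i \<noteq> 0"
  shows "jacobi_matrix (scaled_polys lam \<sigma> B) (\<lambda>i j. 1 / lam * (\<sigma> i * J i j * inverse (\<sigma> j)))"
    (is "jacobi_matrix _ ?P")
  unfolding jacobi_matrix_def
proof
  fix i
  let ?q = "[:0, lam:]"
  have supp: "{j. ?P i j \<noteq> 0} = {j. J i j \<noteq> 0}"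
    using lam \<sigma> by auto
  have fin: "finite {j. J i j \<noteq> 0}"
    and eq: "(\<Sum>j | J i j \<noteq> 0. smult (J i j) (B j)) = [:0, 1:] * B i"
    using J by (auto simp: jacobi_matrix_def)
  have "(\<Sum>j | J i j \<noteq> 0. smult (?P i j) (scaled_polys lam \<sigma> B j))
      = (\<Sum>j | J i j \<noteq> 0. smult (\<sigma> i / lam) (pcompose (smult (J i j) (B j)) ?q))"
    using \<sigma> by (intro sum.cong) (auto simp: scaled_polys_def pcompose_smult field_simps)
  also have "\<dots> = smult (\<sigma> i / lam) (pcompose (\<Sum>j | J i j \<noteq> 0. smult (J i j) (B j)) ?q)"
    unfolding pcompose_sum using fin by (induction rule: finite_induct) (simp_all add: smult_add_right)
  also have "\<dots> = smult (\<sigma> i / lam) (?q * pcompose (B i) ?q)"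
    by (simp only: eq pcompose_mult) (simp add: pcompose_pCons)
  also have "\<dots> = [:0, 1:] * scaled_polys lam \<sigma> B i"
    using lam by (simp add: scaled_polys_def mult.commute)
  finally show "finite {j. ?P i j \<noteq> 0} \<and>
      (\<Sum>j | ?P i j \<noteq> 0. smult (?P i j) (scaled_polys lam \<sigma> B j)) = [:0, 1:] * scaled_polys lam \<sigma> B i"
    using fin unfolding supp by blast
qed

lemma jacobi_matrix_scaled_polys_iff:
  assumes "graded_family B" and "jacobi_matrix B J" and "lam \<noteq> 0" and "\<And>i. \<sigma> i \<noteq> 0"
  shows "jacobi_matrix (scaled_polys lam \<sigma> B) P \<longleftrightarrow>
    P = (\<lambda>i j. 1 / lam * (\<sigma> i * J i j * inverse (\<sigma> j)))"
proof
  assume "jacobi_matrix (scaled_polys lam \<sigma> B) P"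
  then show "P = (\<lambda>i j. 1 / lam * (\<sigma> i * J i j * inverse (\<sigma> j)))"
    by (rule jacobi_matrix_unique[OF graded_family_scaled_polys[OF assms(1,3,4)] _
      jacobi_matrix_scaled_polys[OF assms(2-4)]])
next
  assume P: "P = (\<lambda>i j. 1 / lam * (\<sigma> i * J i j * inverse (\<sigma> j)))"
  show "jacobi_matrix (scaled_polys lam \<sigma> B) P"
    unfolding P by (rule jacobi_matrix_scaled_polys[OF assms(2-4)])
qed

lemma row_sum_le_matrix_norm_inf:
  assumes J: "bounded_matrix J" and S: "finite S"
  shows "(\<Sum>j\<in>S. \<bar>J i j\<bar>) \<le> enn2real (matrix_norm_inf J)"
proof -
  have "ennreal (\<Sum>j\<in>S. \<bar>J i j\<bar>) = (\<Sum>j\<in>S. ennreal \<bar>J i j\<bar>)"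
    by simp
  also have "\<dots> \<le> (\<Sum>j. ennreal \<bar>J i j\<bar>)"
    using S by (intro sum_le_suminf) auto
  also have "\<dots> \<le> matrix_norm_inf J"
    unfolding matrix_norm_inf_def by (rule SUP_upper) simp
  also have "\<dots> = ennreal (enn2real (matrix_norm_inf J))"
    \<comment> \<open>Boundedness excludes the value infinity, which \<open>enn2real\<close> would
      send to 0.\<close>
    using J by (simp add: bounded_matrix_def)
  finally show ?thesis
    by (simp add: ennreal_le_iff)
qed

section \<open>The eigenvector recursion\<close>

text \<open>Row n of J s = lam s, solved for the component n + 1 when the superdiagonal is 1 and all
  entries beyond it vanish; normalized by s_0 = 1.\<close>

fun eigvec :: "real \<Rightarrow> (nat \<Rightarrow> nat \<Rightarrow> real) \<Rightarrow> nat \<Rightarrow> real" where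
  "eigvec lam J 0 = 1"
| "eigvec lam J (Suc n) = lam * eigvec lam J n - (\<Sum>j\<in>{..n}. J n j * eigvec lam J j)"

declare eigvec.simps(2) [simp del]

text \<open>The solutions form a line, parametrized by the component 0; this is the source of
  uniqueness up to an overall factor. The recursion reaches back to all earlier components, hence
  the strong induction.\<close>

lemma eigvec_unique:
  assumes "\<And>n. v (Suc n) = lam * v n - (\<Sum>j\<in>{..n}. J n j * v j)"
  shows "v n = v 0 * eigvec lam J n"
proof (induction n rule: less_induct)
  case (less n)
  show ?case
  proof (cases n)
    case (Suc m)
    have "(\<Sum>j\<in>{..m}. J m j * v j) = v 0 * (\<Sum>j\<in>{..m}. J m j * eigvec lam J j)"
      unfolding sum_distrib_left
    proof (rule sum.cong[OF refl])
      fix j assume "j \<in> {..m}"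
      then have "v j = v 0 * eigvec lam J j"
        using Suc by (intro less) auto
      then show "J m j * v j = v 0 * (J m j * eigvec lam J j)"
        by (metis mult.left_commute)
    qed
    moreover have "v m = v 0 * eigvec lam J m"
      using Suc by (intro less) auto
    ultimately have "v (Suc m) = lam * (v 0 * eigvec lam J m)
        - v 0 * (\<Sum>j\<in>{..m}. J m j * eigvec lam J j)"
      using assms[of m] by metis
    then show ?thesis
      unfolding Suc eigvec.simps(2) by (simp only: right_diff_distrib mult.left_commute)
  qed simp
qed

text \<open>By monotonicity so far, the sum over row n is at most (lam - 1) s_n, where the
  superdiagonal entry accounts for the subtracted 1. So s_(n+1) \<ge> lam s_n - (lam - 1) s_n =
  s_n.\<close>

lemma eigvec_mono_pos:
  assumes nonneg: "nonneg_matrix J" and row: "\<And>i. (\<Sum>j\<in>{..i}. J i j) + 1 \<le> lam"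
  shows "eigvec lam J n > 0 \<and> (\<forall>j\<le>n. eigvec lam J j \<le> eigvec lam J n)"
proof (induction n)
  case (Suc n)
  let ?s = "eigvec lam J"
  have "(\<Sum>j\<in>{..n}. J n j * ?s j) \<le> (\<Sum>j\<in>{..n}. J n j * ?s n)"
    using Suc nonneg by (intro sum_mono mult_left_mono) (auto simp: nonneg_matrix_def)
  also have "\<dots> = (\<Sum>j\<in>{..n}. J n j) * ?s n"
    by (simp add: sum_distrib_right)
  also have "\<dots> \<le> (lam - 1) * ?s n"
    using row[of n] Suc by (intro mult_right_mono) auto
  finally have "?s n \<le> ?s (Suc n)"
    by (simp add: eigvec.simps(2) algebra_simps)
  then show ?case
    using Suc by (auto simp: le_Suc_eq intro: order_trans)
qed auto

text \<open>Both claims are proved together, following the mutual recursion. The tail is a Horner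
  scheme for the row sum: each division by d_k = s_(k+1) / s_k replaces the common denominator s_k
  by s_(k+1).\<close>

lemma cf_tail_eigvec:
  assumes "\<And>n. eigvec lam J n \<noteq> 0"
  shows "cf_denom lam J m = eigvec lam J (Suc m) / eigvec lam J m"
    and "cf_tail lam J m k = (\<Sum>j<k. J m j * eigvec lam J j) / eigvec lam J k"
  using assms
proof (induction lam J m and lam J m k rule: cf_denom_cf_tail.induct)
  case (1 lam J m)
  have "(\<Sum>j\<in>{..m}. J m j * eigvec lam J j)
      = (\<Sum>j<m. J m j * eigvec lam J j) + J m m * eigvec lam J m"
    by (simp only: lessThan_Suc_atMost[symmetric] sum.lessThan_Suc)
  then show ?case
    using 1 by (simp add: eigvec.simps(2) field_simps)
next
  case (3 lam J m k)
  have IH: "cf_denom lam J k = eigvec lam J (Suc k) / eigvec lam J k"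
      "cf_tail lam J m k = (\<Sum>j<k. J m j * eigvec lam J j) / eigvec lam J k"
    using 3 by blast+
  have "J m k + (\<Sum>j<k. J m j * eigvec lam J j) / eigvec lam J k
      = (\<Sum>j<Suc k. J m j * eigvec lam J j) / eigvec lam J k"
    using "3.prems"[of k] by (simp add: add_divide_distrib)
  then show ?case
    unfolding cf_tail.simps(2) IH using "3.prems"[of k] by simp
qed simp

section \<open>Rational dependence on the entries of J, with lam as a fixed parameter\<close>

lemma entry_polynomial_sum:
  assumes "finite S" and "\<And>j. j \<in> S \<Longrightarrow> entry_polynomial (f j)"
  shows "entry_polynomial (\<lambda>J. \<Sum>j\<in>S. f j J)"
  using assms
proof (induction S rule: finite_induct)
  case empty
  show ?case by (simp add: entry_polynomial.const)
next
  case (insert x S)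
  have "entry_polynomial (\<lambda>J. f x J + (\<Sum>j\<in>S. f j J))"
    using insert by (intro entry_polynomial.add) simp_all
  then show ?case
    using insert by simp
qed

lemma entry_polynomial_eigvec: "entry_polynomial (\<lambda>J. eigvec lam J n)"
proof (induction n rule: less_induct)
  case (less n)
  show ?case
  proof (cases n)
    case 0
    then show ?thesis by (simp add: entry_polynomial.const)
  next
    case (Suc m)
    \<comment> \<open>The difference is rewritten with a factor -1, as
      \<open>entry_polynomial\<close> is generated by sums and products.\<close>
    have "entry_polynomial (\<lambda>J. lam * eigvec lam J m + - 1 * (\<Sum>j\<in>{..m}. J m j * eigvec lam J j))"
      using less Suc by (intro entry_polynomial.intros entry_polynomial_sum) auto
    then show ?thesis
      by (simp add: Suc eigvec.simps(2))
  qed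
qed

text \<open>For \<open>J = (lam - 1) I\<close> the recursion has the constant solution 1, also if \<open>lam = 0\<close>.\<close>

lemma entry_rational_inverse_eigvec: "entry_rational (\<lambda>J. 1 / eigvec lam J n)"
proof -
  let ?J = "\<lambda>i j :: nat. if i = j then lam - 1 else 0"
  have "1 = 1 * eigvec lam ?J n"
  proof (rule eigvec_unique[where v = "\<lambda>_. 1"])
    fix m :: nat
    have "(\<Sum>j\<le>m. ?J m j * 1) = lam - 1"
      by simp
    then show "1 = lam * 1 - (\<Sum>j\<le>m. ?J m j * 1)"
      by linarith
  qed
  then have "eigvec lam ?J n \<noteq> 0" by simp
  then show ?thesis
    unfolding entry_rational_def using entry_polynomial_eigvec entry_polynomial.const by blast
qed

section \<open>Stochastic scalings\<close>

locale jacobi_setting =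
  fixes B :: "nat \<Rightarrow> real poly" and J :: "nat \<Rightarrow> nat \<Rightarrow> real"
  assumes graded: "graded_family B" and monic: "\<And>i. lead_coeff (B i) = 1"
    and jacobi: "jacobi_matrix B J"
begin

text \<open>Trades the recurrence for the scaled polynomials for an explicit formula for P, so that
  the rest is a statement about matrices.\<close>

lemma stochastic_scaling_iff:
  "stochastic_scaling B lam \<sigma> P \<longleftrightarrow> lam \<noteq> 0 \<and> (\<forall>i. \<sigma> i \<noteq> 0) \<and>
     P = (\<lambda>i j. 1 / lam * (\<sigma> i * J i j * inverse (\<sigma> j))) \<and> stochastic_matrix P"
  unfolding stochastic_scaling_def
proof (intro conj_cong refl)
  assume "lam \<noteq> 0" "\<forall>i. \<sigma> i \<noteq> 0"
  then show "jacobi_matrix (scaled_polys lam \<sigma> B) P \<longleftrightarrow>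
      P = (\<lambda>i j. 1 / lam * (\<sigma> i * J i j * inverse (\<sigma> j)))"
    by (intro jacobi_matrix_scaled_polys_iff[OF graded jacobi]) simp_all
qed

text \<open>Multiplying by lam / \<sigma>_i gives row i of J s = lam s for s = 1 / \<sigma>; the
  superdiagonal entry 1 isolates s_(i+1).\<close>

lemma row_sum_eq_1_iff:
  assumes "lam \<noteq> 0" and "\<And>i. \<sigma> i \<noteq> 0"
  shows "(\<Sum>j=0..i+1. 1 / lam * (\<sigma> i * J i j * inverse (\<sigma> j))) = 1 \<longleftrightarrow>
    inverse (\<sigma> (Suc i)) = lam * inverse (\<sigma> i) - (\<Sum>j\<in>{..i}. J i j * inverse (\<sigma> j))"
proof -
  have "(\<Sum>j=0..i+1. 1 / lam * (\<sigma> i * J i j * inverse (\<sigma> j)))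
      = \<sigma> i / lam * (\<Sum>j\<in>{..Suc i}. J i j * inverse (\<sigma> j))"
    unfolding sum_distrib_left by (intro sum.cong) auto
  also have "\<dots> = \<sigma> i / lam * ((\<Sum>j\<in>{..i}. J i j * inverse (\<sigma> j)) + inverse (\<sigma> (Suc i)))"
    using jacobi_matrix_hessenberg(1)[OF graded monic jacobi] by simp
  also have "\<dots> = 1 \<longleftrightarrow>
      (\<Sum>j\<in>{..i}. J i j * inverse (\<sigma> j)) + inverse (\<sigma> (Suc i)) = lam * inverse (\<sigma> i)"
    using assms by (simp add: divide_simps) (auto simp: mult.commute)
  finally show ?thesis by linarith
qed

lemma stochastic_scaling_inverse:
  assumes "stochastic_scaling B lam \<sigma> P"
  shows "inverse (\<sigma> n) = inverse (\<sigma> 0) * eigvec lam J n"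
proof (rule eigvec_unique)
  fix n
  show "inverse (\<sigma> (Suc n)) = lam * inverse (\<sigma> n) - (\<Sum>j\<in>{..n}. J n j * inverse (\<sigma> j))"
    using assms row_sum_eq_1_iff[of lam \<sigma> n]
    unfolding stochastic_scaling_iff stochastic_matrix_def by blast
qed

lemma stochastic_scaling_eigvec:
  assumes "stochastic_scaling B lam \<sigma> P"
  shows "\<sigma> n = 1 / eigvec lam J n * \<sigma> 0" and "eigvec lam J n \<noteq> 0"
proof -
  have nz: "\<sigma> i \<noteq> 0" for i
    using assms by (simp add: stochastic_scaling_def)
  have "\<sigma> n = inverse (inverse (\<sigma> 0) * eigvec lam J n)"
    by (subst stochastic_scaling_inverse[OF assms, symmetric]) simp
  then show "\<sigma> n = 1 / eigvec lam J n * \<sigma> 0"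
    by (simp add: divide_inverse)
  \<comment> \<open>Since 1 / 0 = 0, a vanishing component would force
    \<open>\<sigma> n = 0\<close>.\<close>
  with nz[of n] show "eigvec lam J n \<noteq> 0" by auto
qed

text \<open>For the same lam, \<sigma> and \<sigma>' are both multiples of 1 / s, hence
  proportional. Conversely, a common factor cancels in each quotient \<sigma>_i / \<sigma>_j, which
  leaves P unchanged.\<close>

lemma stochastic_scaling_unique:
  assumes \<sigma>: "stochastic_scaling B lam \<sigma> P"
  shows "stochastic_scaling B lam \<sigma>' P' \<longleftrightarrow> P' = P \<and> (\<exists>c. c \<noteq> 0 \<and> (\<forall>i. \<sigma>' i = c * \<sigma> i))"
proof -
  have *: "(\<lambda>i j. 1 / lam * (\<sigma>' i * J i j * inverse (\<sigma>' j))) = P"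
    if "c \<noteq> 0" "\<forall>i. \<sigma>' i = c * \<sigma> i" for c
    using that \<sigma> unfolding stochastic_scaling_iff by (auto simp: fun_eq_iff)
  show ?thesis
  proof
    assume \<sigma>': "stochastic_scaling B lam \<sigma>' P'"
    have nz: "\<sigma> 0 \<noteq> 0" "\<sigma>' 0 \<noteq> 0"
      using \<sigma> \<sigma>' by (simp_all add: stochastic_scaling_def)
    have "\<sigma>' i = \<sigma>' 0 / \<sigma> 0 * \<sigma> i" for i
      using stochastic_scaling_eigvec(1)[OF \<sigma>, of i] stochastic_scaling_eigvec(1)[OF \<sigma>', of i] nz
      by simp
    moreover have "\<sigma>' 0 / \<sigma> 0 \<noteq> 0" using nz by simp
    ultimately have c: "\<exists>c. c \<noteq> 0 \<and> (\<forall>i. \<sigma>' i = c * \<sigma> i)" by blast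
    then have "P' = P"
      using * \<sigma>' unfolding stochastic_scaling_iff by blast
    with c show "P' = P \<and> (\<exists>c. c \<noteq> 0 \<and> (\<forall>i. \<sigma>' i = c * \<sigma> i))" by blast
  next
    assume "P' = P \<and> (\<exists>c. c \<noteq> 0 \<and> (\<forall>i. \<sigma>' i = c * \<sigma> i))"
    then obtain c where c: "P' = P" "c \<noteq> 0" "\<forall>i. \<sigma>' i = c * \<sigma> i" by blast
    show "stochastic_scaling B lam \<sigma>' P'"
      unfolding stochastic_scaling_iff *[OF c(2,3)]
      using \<sigma> c by (simp add: stochastic_scaling_def)
  qed
qed

section \<open>Existence and monotonicity when lam is at least the norm of J\<close>

context
  fixes lam :: real
  assumes nonneg: "nonneg_matrix J" and bounded: "bounded_matrix J"
    and lam: "lam \<ge> enn2real (matrix_norm_inf J)"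
begin

lemma row_sum_bound: "(\<Sum>j\<in>{..i}. J i j) + 1 \<le> lam"
proof -
  have "(\<Sum>j\<in>{..i}. J i j) + 1 = (\<Sum>j\<in>{..Suc i}. \<bar>J i j\<bar>)"
    using nonneg jacobi_matrix_hessenberg(1)[OF graded monic jacobi]
    by (simp add: nonneg_matrix_def)
  also have "\<dots> \<le> lam"
    using row_sum_le_matrix_norm_inf[OF bounded, of "{..Suc i}" i] lam by simp
  finally show ?thesis .
qed

lemma lam_pos: "lam > 0"
proof -
  have "J 0 0 + 1 \<le> lam" using row_sum_bound[of 0] by simp
  moreover have "J 0 0 \<ge> 0" using nonneg by (simp add: nonneg_matrix_def)
  ultimately show ?thesis by linarith
qed

lemma eigvec_pos: "eigvec lam J n > 0"
  and eigvec_le_Suc: "eigvec lam J n \<le> eigvec lam J (Suc n)"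
proof -
  show "eigvec lam J n > 0"
    by (rule conjunct1[OF eigvec_mono_pos[OF nonneg row_sum_bound]])
  show "eigvec lam J n \<le> eigvec lam J (Suc n)"
    by (rule conjunct2[OF eigvec_mono_pos[OF nonneg row_sum_bound], THEN spec, THEN mp]) simp
qed

lemma stochastic_scaling_exists: "\<exists>\<sigma> P. stochastic_scaling B lam \<sigma> P"
proof -
  \<comment> \<open>The solution with \<sigma>_0 = 1; its row sum condition is the defining
    recursion of \<open>eigvec\<close>.\<close>
  define \<sigma> where "\<sigma> = (\<lambda>i. inverse (eigvec lam J i))"
  define P where "P = (\<lambda>i j. 1 / lam * (\<sigma> i * J i j * inverse (\<sigma> j)))"
  have pos: "\<sigma> i > 0" for i
    using eigvec_pos by (simp add: \<sigma>_def)
  then have nz: "\<sigma> i \<noteq> 0" for i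
    by (metis less_irrefl)
  have P0: "0 \<le> P i j" for i j
    using lam_pos pos[of i] pos[of j] nonneg by (simp add: P_def nonneg_matrix_def)
  have sum1: "(\<Sum>j=0..i+1. P i j) = 1" for i
    using row_sum_eq_1_iff[of lam \<sigma> i] lam_pos nz
    by (simp add: P_def \<sigma>_def eigvec.simps(2))
  \<comment> \<open>Up to column i + 1 an entry is one of nonnegative summands with total 1; beyond
    it the Hessenberg shape gives 0.\<close>
  have P1: "P i j \<le> 1" for i j
  proof (cases "j \<le> i + 1")
    case True
    then have "P i j \<le> (\<Sum>j=0..i+1. P i j)"
      using P0 by (intro member_le_sum) auto
    then show ?thesis by (simp only: sum1)
  next
    case False
    then show ?thesis
      using jacobi_matrix_hessenberg(2)[OF graded monic jacobi, of i j] by (simp add: P_def)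
  qed
  have "stochastic_scaling B lam \<sigma> P"
    unfolding stochastic_scaling_iff stochastic_matrix_def
    using lam_pos nz P0 P1 sum1 P_def by auto
  then show ?thesis by blast
qed

text \<open>\<sigma>_n = \<sigma>_0 / s_n with s positive and nondecreasing, so the sign of
  \<sigma>_0 decides the direction.\<close>

lemma stochastic_scaling_monotone:
  assumes "stochastic_scaling B lam \<sigma> P"
  shows "\<sigma> 0 > 0 \<Longrightarrow> \<sigma> i \<ge> \<sigma> (Suc i) \<and> \<sigma> i > 0"
    and "\<sigma> 0 < 0 \<Longrightarrow> \<sigma> i \<le> \<sigma> (Suc i) \<and> \<sigma> i < 0"
proof -
  have eq: "\<sigma> n = \<sigma> 0 / eigvec lam J n" for n
    using stochastic_scaling_eigvec(1)[OF assms, of n] by simp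
  show "\<sigma> i \<ge> \<sigma> (Suc i) \<and> \<sigma> i > 0" if "\<sigma> 0 > 0"
    unfolding eq[of i] eq[of "Suc i"]
    using that eigvec_pos[of i] eigvec_pos[of "Suc i"] eigvec_le_Suc[of i]
    by (auto intro!: divide_left_mono)
  show "\<sigma> i \<le> \<sigma> (Suc i) \<and> \<sigma> i < 0" if "\<sigma> 0 < 0"
    unfolding eq[of i] eq[of "Suc i"]
    using that eigvec_pos[of i] eigvec_pos[of "Suc i"] eigvec_le_Suc[of i]
    by (auto intro!: divide_left_mono_neg simp: divide_neg_pos)
qed

end

text \<open>With i = m + 1, the ratio is s_m / s_(m+1), the reciprocal of the denominator d_m. Any
  lam admitting a stochastic scaling will do.\<close>

lemma stochastic_scaling_continued_fraction:
  assumes \<sigma>: "stochastic_scaling B lam \<sigma> P" and "i \<ge> 1"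
  shows "\<sigma> i / \<sigma> (i - 1) = continued_fraction lam J i"
proof -
  obtain m where m: "i = Suc m"
    using \<open>i \<ge> 1\<close> by (cases i) auto
  have nz: "\<sigma> 0 \<noteq> 0"
    using \<sigma> by (simp add: stochastic_scaling_def)
  have "continued_fraction lam J i = eigvec lam J m / eigvec lam J (Suc m)"
    using cf_tail_eigvec(1)[OF stochastic_scaling_eigvec(2)[OF \<sigma>], of m]
    by (simp add: m continued_fraction_def del: cf_denom.simps)
  also have "\<dots> = \<sigma> i / \<sigma> (i - 1)"
    using stochastic_scaling_eigvec(1)[OF \<sigma>, of m] stochastic_scaling_eigvec(1)[OF \<sigma>, of "Suc m"]
      stochastic_scaling_eigvec(2)[OF \<sigma>] nz
    by (simp add: m)
  finally show ?thesis by simp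
qed

end

section \<open>Application to multiple orthogonal polynomials\<close>

lemma jacobi_setting_multiple_orthogonal:
  assumes "multiple_orthogonal_polys \<epsilon> M p n w B" and "jacobi_matrix B J"
  shows "jacobi_setting B J"
proof -
  have l: "degree (B l) = l \<and> lead_coeff (B l) = 1 \<and>
      (\<forall>j<l. signed_integral \<epsilon> M (\<lambda>x. poly (B l) x * wmonom p n w j x) = 0)" for l
    using assms(1) unfolding multiple_orthogonal_polys_def by (rule spec)
  show ?thesis
  proof
    show lc: "lead_coeff (B i) = 1" for i
      by (rule conjunct1[OF conjunct2[OF l]])
    \<comment> \<open>The degree condition alone would admit the zero polynomial at i = 0; the
      leading coefficient 1 rules it out.\<close>
    have "B i \<noteq> 0" for i
      by (rule notI) (use lc[of i] in simp)
    with l show "graded_family B"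
      by (simp add: graded_family_def)
    show "jacobi_matrix B J"
      by (rule assms(2))
  qed
qed

theorem mainTheorem17:
  "\<exists>f :: real \<Rightarrow> nat \<Rightarrow> (nat \<Rightarrow> nat \<Rightarrow> real) \<Rightarrow> real.
     (\<forall>lam n. entry_rational (f lam n)) \<and>
     (\<forall>\<Delta> \<epsilon> M p n w B J.
        weight_system \<Delta> \<epsilon> M p n w \<and>
        multiple_orthogonal_polys \<epsilon> M p n w B \<and>
        jacobi_matrix B J \<and> nonneg_matrix J \<and> bounded_matrix J \<longrightarrow>
        (\<exists>lam \<sigma> P. stochastic_scaling B lam \<sigma> P) \<and>
        (\<forall>lam \<sigma> P. stochastic_scaling B lam \<sigma> P \<longrightarrow>
           (\<forall>\<sigma>' P'. stochastic_scaling B lam \<sigma>' P' \<longleftrightarrow>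
              P' = P \<and> (\<exists>c. c \<noteq> 0 \<and> (\<forall>i. \<sigma>' i = c * \<sigma> i)))) \<and>
        (\<forall>lam \<ge> enn2real (matrix_norm_inf J).
           (\<exists>\<sigma> P. stochastic_scaling B lam \<sigma> P) \<and>
           (\<forall>\<sigma> P. stochastic_scaling B lam \<sigma> P \<longrightarrow>
              (\<forall>i j. P i j = 1 / lam * (\<sigma> i * J i j * inverse (\<sigma> j))) \<and>
              (\<sigma> 0 > 0 \<longrightarrow> (\<forall>i. \<sigma> i \<ge> \<sigma> (Suc i) \<and> \<sigma> i > 0)) \<and>
              (\<sigma> 0 < 0 \<longrightarrow> (\<forall>i. \<sigma> i \<le> \<sigma> (Suc i) \<and> \<sigma> i < 0)) \<and>
              (\<forall>i\<ge>1. \<sigma> i / \<sigma> (i - 1) = continued_fraction lam J i) \<and>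
              (\<forall>i. \<sigma> i = f lam i J * \<sigma> 0))))"
proof (intro exI[of _ "\<lambda>lam n J. 1 / eigvec lam J n"] conjI allI impI;
    (elim conjE)?)
  fix lam n
  show "entry_rational (\<lambda>J. 1 / eigvec lam J n)"
    by (rule entry_rational_inverse_eigvec)
next
  fix \<Delta> :: "real set" and \<epsilon> :: real and M :: "real measure" and p n w B J
  assume "multiple_orthogonal_polys \<epsilon> M p n w B" "jacobi_matrix B J"
  then interpret jacobi_setting B J
    by (rule jacobi_setting_multiple_orthogonal)
  assume nb: "nonneg_matrix J" "bounded_matrix J"
  show "\<exists>lam \<sigma> P. stochastic_scaling B lam \<sigma> P"
    \<comment> \<open>The norm of J itself serves as lam.\<close>
    using stochastic_scaling_exists[OF nb order_refl] by blast
  {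
    fix lam \<sigma> P \<sigma>' P'
    assume "stochastic_scaling B lam \<sigma> P"
    then show "stochastic_scaling B lam \<sigma>' P' \<longleftrightarrow>
        P' = P \<and> (\<exists>c. c \<noteq> 0 \<and> (\<forall>i. \<sigma>' i = c * \<sigma> i))"
      by (rule stochastic_scaling_unique)
  }
  fix lam
  assume lam: "lam \<ge> enn2real (matrix_norm_inf J)"
  show "\<exists>\<sigma> P. stochastic_scaling B lam \<sigma> P"
    by (rule stochastic_scaling_exists[OF nb lam])
  fix \<sigma> P
  assume \<sigma>: "stochastic_scaling B lam \<sigma> P"
  show "P i j = 1 / lam * (\<sigma> i * J i j * inverse (\<sigma> j))" for i j
    using \<sigma> unfolding stochastic_scaling_iff by simp
  show "\<sigma> 0 > 0 \<Longrightarrow> \<sigma> i \<ge> \<sigma> (Suc i)" "\<sigma> 0 > 0 \<Longrightarrow> \<sigma> i > 0"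
    "\<sigma> 0 < 0 \<Longrightarrow> \<sigma> i \<le> \<sigma> (Suc i)" "\<sigma> 0 < 0 \<Longrightarrow> \<sigma> i < 0" for i
    using stochastic_scaling_monotone[OF nb lam \<sigma>] by auto
  show "\<sigma> i / \<sigma> (i - 1) = continued_fraction lam J i" if "1 \<le> i" for i
    by (rule stochastic_scaling_continued_fraction[OF \<sigma> that])
  show "\<sigma> i = 1 / eigvec lam J i * \<sigma> 0" for i
    by (rule stochastic_scaling_eigvec(1)[OF \<sigma>])
qed

end
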